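(* Let $\mathbb{F}$ be an algebraically closed field and let $n\ge 3$. There exist an infinite family of matrices $(X_\alpha)_\alpha$ in $M_n(\mathbb{F})$ and a rank-one matrix $Z\in M_n(\mathbb{F})$ such that $d(X_\alpha,X_\beta)=4$ for all indices $\alpha\ne\beta$, and $d(X_\alpha,Z)=2$ for all $\alpha$, where $d$ is the distance in the commuting graph $\Gamma(M_n(\mathbb{F}))$.
   Context: The commuting graph $\Gamma(M_n(\mathbb{F}))$ is the simple graph whose vertices are all non-scalar matrices in $M_n(\mathbb{F})$; two vertices $X\ne Y$ are joined by an edge iff $XY=YX$. $d(X,Y)$ is the length of a shortest path between vertices $X$ and $Y$. *)

theory Defs
  imports
    "Jordan_Normal_Form.DL_Rank"
    "HOL-Computational_Algebra.Polynomial"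
    "Graph_Theory.Pair_Digraph"
    "Graph_Theory.Shortest_Path"
begin

definition scalar_mat :: "nat \<Rightarrow> 'a::field mat \<Rightarrow> bool" where
  "scalar_mat n A \<longleftrightarrow> (\<exists>c. A = c \<cdot>\<^sub>m 1\<^sub>m n)"

text \<open>The undirected edge between \<open>A\<close> and \<open>B\<close> is represented by the two arcs
  \<open>(A, B)\<close> and \<open>(B, A)\<close>.\<close>

definition commuting_graph :: "nat \<Rightarrow> 'a::field mat pair_pre_digraph" where
  "commuting_graph n =
    (let V = {A \<in> carrier_mat n n. \<not> scalar_mat n A}
     in \<lparr> pverts = V,
          parcs = {(A, B). A \<in> V \<and> B \<in> V \<and> A \<noteq> B \<and> A * B = B * A} \<rparr>)"

lemma pair_bidirected_digraph_commuting_graph: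
  "pair_bidirected_digraph (commuting_graph n)"
  by unfold_locales
    (auto simp: commuting_graph_def Let_def symmetric_def sym_def)

text \<open>With every arc of weight 1 the cost of a walk is its length, so the value below is the
  length of a shortest path, and \<open>\<infinity>\<close> if there is none.  It is meaningful
  only for vertices of the graph.\<close>

definition commuting_dist :: "nat \<Rightarrow> 'a::field mat \<Rightarrow> 'a mat \<Rightarrow> ereal" where
  "commuting_dist n A B = wf_digraph.\<mu> (with_proj (commuting_graph n)) (\<lambda>_. 1) A B"

text \<open>The infimum over walks is the minimum over paths, which justifies this reading.\<close>

lemma (in wf_digraph) mu_unit_eq_iff:
  "\<mu> (\<lambda>_. 1) u v = ereal (real k) \<longleftrightarrow>
    (\<exists>p. apath u p v \<and> length p = k) \<and> (\<forall>p. apath u p v \<longrightarrow> k \<le> length p)"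
proof -
  have cost: "awalk_cost (\<lambda>_. 1) p = real (length p)" for p
    by (induction p) auto
  have path: "\<exists>q. apath u q v \<and> length q \<le> length p" if "awalk u p v" for p
  proof (intro exI conjI)
    show "apath u (awalk_to_apath p) v"
      using that by (rule apath_awalk_to_apath)
    have "awalk_cost (\<lambda>_. 1) (awalk_to_apath p) \<le> awalk_cost (\<lambda>_. 1) p"
      using that by (rule awalk_to_path_no_neg_cyc_cost) (auto simp: cost)
    then show "length (awalk_to_apath p) \<le> length p"
      by (simp add: cost)
  qed
  define m where "m = (LEAST l. \<exists>p. apath u p v \<and> length p = l)"
  show ?thesis
  proof (cases "\<exists>p. apath u p v")
    case False
    then have "{p. awalk u p v} = {}" using path by blast
    then have "\<mu> (\<lambda>_. 1) u v = \<infinity>" by (simp add: \<mu>_def top_ereal_def)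
    with False show ?thesis by auto
  next
    case True
    then have ex: "\<exists>l p. apath u p v \<and> length p = l" by blast
    obtain p where p: "apath u p v" "length p = m"
      using LeastI_ex[OF ex] unfolding m_def by blast
    have le: "m \<le> length q" if "apath u q v" for q
      unfolding m_def by (rule Least_le) (use that in blast)
    have "\<mu> (\<lambda>_. 1) u v = ereal (real m)"
    proof (rule antisym)
      show "\<mu> (\<lambda>_. 1) u v \<le> ereal (real m)"
        using min_cost_le_walk_cost[OF awalkI_apath[OF p(1)], of "\<lambda>_. 1"] p(2)
        by (simp add: cost)
      show "ereal (real m) \<le> \<mu> (\<lambda>_. 1) u v"
        unfolding \<mu>_def
      proof (rule INF_greatest)
        fix q assume "q \<in> {q. awalk u q v}"
        then obtain r where "apath u r v" "length r \<le> length q" using path by blast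
        with le[of r] show "ereal (real m) \<le> ereal (awalk_cost (\<lambda>_. 1) q)"
          by (simp add: cost)
      qed
    qed
    moreover have "m = k \<longleftrightarrow>
        (\<exists>p. apath u p v \<and> length p = k) \<and> (\<forall>p. apath u p v \<longrightarrow> k \<le> length p)"
      using p le by (metis le_antisym)
    ultimately show ?thesis by simp
  qed
qed

lemma commuting_dist_eq_iff:
  "commuting_dist n A B = ereal (real k) \<longleftrightarrow>
    (\<exists>p. pre_digraph.apath (with_proj (commuting_graph n)) A p B \<and> length p = k) \<and>
    (\<forall>p. pre_digraph.apath (with_proj (commuting_graph n)) A p B \<longrightarrow> k \<le> length p)"
proof -
  interpret pair_bidirected_digraph "commuting_graph n"
    by (rule pair_bidirected_digraph_commuting_graph)
  show ?thesis
    unfolding commuting_dist_def by (rule mu_unit_eq_iff)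
qed

end

theory Submission
  imports Defs
begin

text \<open>
  Let \<open>J\<close> be the nilpotent Jordan block and \<open>S\<^sub>t = 1 + t N\<close>, where \<open>N\<close> sends the basis vector
  \<open>e\<^sub>j\<close> to \<open>e\<^bsub>n-1-j\<^esub>\<close> for \<open>j < n-1-j\<close> and to \<open>0\<close> otherwise, so that \<open>S\<^sub>s S\<^sub>t = S\<^bsub>s+t\<^esub>\<close>.  Put
  \<open>X\<^sub>\<alpha> = S\<^sub>\<alpha> J S\<^bsub>-\<alpha>\<^esub>\<close>.  With \<open>V\<^sub>k\<close> the span of the first \<open>k\<close> basis vectors, the flags \<open>V\<close> and
  \<open>S\<^sub>t V\<close> are opposite for \<open>t \<noteq> 0\<close>: \<open>V\<^bsub>n-l\<^esub> \<inter> S\<^sub>t V\<^sub>l = 0\<close>.  Up to scalars, non-scalar matrices \<open>A\<close>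
  and \<open>B\<close> commuting with \<open>X\<^sub>\<alpha>\<close> and \<open>X\<^sub>\<beta>\<close> are nilpotent, with kernels and images in the respective
  flags; say \<open>dim ker B = l \<le> k = dim ker A\<close>.  If they commuted, the nilpotent \<open>B\<close> would act on the
  image of \<open>A\<close> and kill a nonzero vector there, which lies in the member of dimension \<open>n-k \<le> n-l\<close>
  of one flag and in the member of dimension \<open>l\<close> of the other, a contradiction.  Hence distinct
  \<open>X\<^sub>\<alpha>\<close> are at distance at least 4.  Conversely \<open>S\<^sub>\<alpha> E\<^bsub>0,n-1\<^esub> S\<^bsub>-\<alpha>\<^esub>\<close> lives on the coordinates \<open>0\<close>
  and \<open>n-1\<close>, so it commutes with \<open>Z = E\<^bsub>1,1\<^esub>\<close> (indices start at 0).
\<close>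

section \<open>Infinite fields and the rank of matrix units\<close>

text \<open>Over a finite field, 1 plus the product of all \<open>x - a\<close> would be a
  nonconstant polynomial without a root.\<close>

lemma infinite_UNIV_alg_closed_field: "infinite (UNIV :: 'a::alg_closed_field set)"
proof
  assume fin: "finite (UNIV :: 'a set)"
  define p :: "'a poly" where "p = (\<Prod>a\<in>UNIV. [:- a, 1:])"
  have deg: "degree p = card (UNIV :: 'a set)"
    unfolding p_def by (subst degree_prod_sum_eq) auto
  moreover have "card (UNIV :: 'a set) > 0"
    using fin by (simp add: card_gt_0_iff)
  ultimately have "degree (p + 1) > 0"
    by (simp add: degree_add_eq_left)
  then obtain x where "poly (p + 1) x = 0"
    using alg_closed_imp_poly_has_root by blast
  moreover have "poly p x = 0"
    using fin by (auto simp: p_def poly_prod prod_zero_iff)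
  ultimately show False by simp
qed

definition mat_unit :: "nat \<Rightarrow> nat \<Rightarrow> nat \<Rightarrow> 'a::field mat" where
  "mat_unit n a b = mat n n (\<lambda>(i, j). if i = a \<and> j = b then 1 else 0)"

lemma rank_mat_unit:
  assumes "a < n" "b < n"
  shows "vec_space.rank n (mat_unit n a b :: 'a::field mat) = 1"
proof -
  interpret vec_space "TYPE('a)" n .
  let ?E = "mat_unit n a b :: 'a mat"
  have E: "?E \<in> carrier_mat n n"
    by (simp add: mat_unit_def)
  have "rank ?E \<le> 1"
    by (rule rank_le_1_product_entries[OF E, of "\<lambda>i. if i = a then 1 else 0" "\<lambda>j. if j = b then 1 else 0"])
      (auto simp: mat_unit_def)
  moreover have "1 \<le> rank ?E"
  proof -
    have "col ?E b = unit_vec n a"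
      using assms by (auto simp: mat_unit_def unit_vec_def)
    moreover have "col ?E b \<in> set (cols ?E)"
      using assms E by (simp add: cols_def)
    ultimately have "{unit_vec n a} \<subseteq> set (cols ?E)"
      by simp
    moreover have "lin_indpt {unit_vec n a}"
    proof (rule subset_li_is_li)
      show "lin_indpt (set (unit_vecs n))"
        using unit_vecs_basis basis_def by blast
      show "{unit_vec n a} \<subseteq> set (unit_vecs n)"
        using assms by (auto simp: unit_vecs_def)
    qed
    ultimately show ?thesis
      using rank_ge_card_indpt[OF E, of "{unit_vec n a}"] by simp
  qed
  ultimately show ?thesis by simp
qed

section \<open>Shears and opposite flags\<close>

text \<open>The tests are nested so that sums over \<open>j\<close> collapse termwise. For odd
  \<open>n\<close> the strict inequality leaves the middle coordinate alone.\<close>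

definition shear :: "nat \<Rightarrow> 'a::field \<Rightarrow> 'a mat" where
  "shear n t = mat n n (\<lambda>(i, j).
     (if j = i then 1 else 0) + (if j = n - 1 - i then if n - 1 - i < i then t else 0 else 0))"

lemma shear_carrier [simp]: "shear n t \<in> carrier_mat n n"
  by (simp add: shear_def)

lemma shear_mult_vec:
  assumes "u \<in> carrier_vec n" "i < n"
  shows "(shear n t *\<^sub>v u) $ i = u $ i + (if n - 1 - i < i then t * u $ (n - 1 - i) else 0)"
  using assms
  by (simp add: shear_def scalar_prod_def distrib_right sum.distrib if_distrib[of "\<lambda>x. x * _"]
      cong: if_cong)

text \<open>The part below the diagonal squares to 0: its image lies in the coordinates
  \<open>i > n - 1 - i\<close>, which it kills.\<close>

lemma shear_mult:
  "shear n s * shear n t = shear n (s + t)"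
proof (rule eq_matI)
  fix i j assume "i < dim_row (shear n (s + t))" "j < dim_col (shear n (s + t))"
  then have ij: "i < n" "j < n"
    by (auto simp: shear_def)
  have "(shear n s * shear n t) $$ (i, j) = (shear n s *\<^sub>v col (shear n t) j) $ i"
    using ij by (simp add: shear_def)
  then show "(shear n s * shear n t) $$ (i, j) = shear n (s + t) $$ (i, j)"
    using ij by (simp add: shear_mult_vec[OF col_carrier_vec[OF _ shear_carrier]]) (auto simp: shear_def)
qed (auto simp: shear_def)

lemma shear_0: "shear n 0 = 1\<^sub>m n"
  by (auto simp: shear_def)

text \<open>The shear mixes only the coordinates \<open>j\<close> and \<open>n - 1 - j\<close>, so
  each such pair can be treated alone. This is the opposition of the two flags.\<close>

lemma shear_transversal:
  assumes u: "u \<in> carrier_vec n" and t: "t \<noteq> 0"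
    and ge_l: "\<And>i. i < n \<Longrightarrow> l \<le> i \<Longrightarrow> u $ i = 0"
    and image: "\<And>i. i < n \<Longrightarrow> n - l \<le> i \<Longrightarrow> (shear n t *\<^sub>v u) $ i = 0"
  shows "u = 0\<^sub>v n"
proof -
  \<comment> \<open>On the first half, middle included, the shear changes no coordinate. The second
    half then follows through the mirror index.\<close>
  have lower: "u $ j = 0" if "j \<le> n - 1 - j" "j < n" for j
  proof (cases "l \<le> j \<or> j = n - 1 - j")
    case True
    show ?thesis
    proof (cases "l \<le> j")
      case False
      with True that have "n - l \<le> j" by linarith
      then show ?thesis
        using image[OF that(2)] that by (simp add: shear_mult_vec[OF u that(2)])
    qed (use ge_l that in auto)
  next
    case False
    show ?thesis
    proof (cases "n - l \<le> j")
      case True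
      then show ?thesis
        using image[OF that(2)] that by (simp add: shear_mult_vec[OF u that(2)])
    next
      case nl: False
      \<comment> \<open>Both hypotheses apply at the mirror index, where the shear reads
        \<open>u $ ?i + t * u $ j\<close> and only the second term can survive.\<close>
      let ?i = "n - 1 - j"
      have i: "?i < n" "l \<le> ?i" "n - l \<le> ?i" "n - 1 - ?i = j" "j < ?i"
        using that False nl by linarith+
      then have "t * u $ j = 0"
        using image[of ?i] ge_l[of ?i] shear_mult_vec[OF u i(1), of t] by simp
      then show ?thesis using t by simp
    qed
  qed
  have "u $ i = 0" if "i < n" for i
  proof (cases "i \<le> n - 1 - i \<or> l \<le> i")
    case False
    then have i: "n - l \<le> i" "n - 1 - i < i" "n - 1 - i \<le> n - 1 - (n - 1 - i)" "n - 1 - i < n"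
      using that by linarith+
    then show ?thesis
      using image[OF that i(1)] lower[OF i(3,4)] shear_mult_vec[OF u that, of t] by simp
  qed (use lower ge_l that in auto)
  then show ?thesis using u by auto
qed

section \<open>Strictly upper triangular band matrices\<close>

text \<open>This models a non-scalar matrix commuting with \<open>J\<close>, once its diagonal is
  removed. Having no zero on superdiagonal \<open>k\<close> makes the kernel exactly
  \<open>V\<^sub>k\<close>.\<close>

definition strict_band :: "nat \<Rightarrow> nat \<Rightarrow> 'a::field mat \<Rightarrow> bool" where
  "strict_band n k A \<longleftrightarrow> A \<in> carrier_mat n n \<and> 1 \<le> k \<and> k < n \<and>
     (\<forall>i<n. \<forall>j<n. j < i + k \<longrightarrow> A $$ (i, j) = 0) \<and>
     (\<forall>i. i + k < n \<longrightarrow> A $$ (i, i + k) \<noteq> 0)"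

lemma mult_mat_vec_index:
  assumes "A \<in> carrier_mat n n" "u \<in> carrier_vec n" "i < n"
  shows "(A *\<^sub>v u) $ i = (\<Sum>j<n. A $$ (i, j) * u $ j)"
  using assms by (auto simp: scalar_prod_def lessThan_atLeast0)

text \<open>Back substitution from the last coordinate: in row \<open>i - l\<close> only column
  \<open>i\<close> remains once the later coordinates are known to vanish.\<close>

lemma strict_band_kernel:
  assumes B: "strict_band n l B" and u: "u \<in> carrier_vec n" and Bu: "B *\<^sub>v u = 0\<^sub>v n"
    and i: "i < n" "l \<le> i"
  shows "u $ i = 0"
  using i
proof (induction "n - i" arbitrary: i rule: less_induct)
  case less
  have "0 = (B *\<^sub>v u) $ (i - l)"
    using Bu less.prems by simp
  also have "\<dots> = (\<Sum>j<n. B $$ (i - l, j) * u $ j)"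
    using B u less.prems by (intro mult_mat_vec_index) (auto simp: strict_band_def)
  also have "\<dots> = (\<Sum>j<n. if j = i then B $$ (i - l, i) * u $ i else 0)"
  proof (rule sum.cong)
    fix j assume j: "j \<in> {..<n}"
    consider "j < i" | "j = i" | "i < j" by linarith
    then show "B $$ (i - l, j) * u $ j = (if j = i then B $$ (i - l, i) * u $ i else 0)"
    proof cases
      case 1
      then show ?thesis using B less.prems j by (simp add: strict_band_def)
    next
      case 3
      then show ?thesis using less.hyps[of j] less.prems j by simp
    qed simp
  qed simp
  also have "\<dots> = B $$ (i - l, i) * u $ i"
    using less.prems by simp
  finally have "B $$ (i - l, i) * u $ i = 0" by simp
  moreover have "j + l < n \<Longrightarrow> B $$ (j, j + l) \<noteq> 0" for j
    using B by (simp add: strict_band_def)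
  from this[of "i - l"] have "B $$ (i - l, i) \<noteq> 0"
    using less.prems by simp
  ultimately show ?case
    using less.prems by simp
qed

text \<open>Multiplication lowers the height of a vector by \<open>k\<close>. For
  \<open>i + k \<ge> n\<close> the hypothesis \<open>h\<close> is vacuous, which bounds the height
  of the whole image by \<open>n - k\<close>.\<close>

lemma strict_band_mult_vec_eq_0:
  assumes A: "strict_band n k A" and u: "u \<in> carrier_vec n" and i: "i < n"
    and h: "\<And>j. j < n \<Longrightarrow> i + k \<le> j \<Longrightarrow> u $ j = 0"
  shows "(A *\<^sub>v u) $ i = 0"
proof -
  have "A $$ (i, j) * u $ j = 0" if "j < n" for j
    using A h[OF that] that i by (cases "i + k \<le> j") (auto simp: strict_band_def)
  moreover have "(A *\<^sub>v u) $ i = (\<Sum>j<n. A $$ (i, j) * u $ j)"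
    using A u i by (intro mult_mat_vec_index) (auto simp: strict_band_def)
  ultimately show ?thesis by (simp add: sum.neutral del: mult_eq_0_iff)
qed

text \<open>\<open>SC\<close> makes \<open>C\<close> a conjugate of \<open>A\<close> without
  mentioning an inverse. The argument forces \<open>C = 0\<close>, hence \<open>A = 0\<close>,
  against the nonzero superdiagonal of \<open>A\<close>.\<close>

lemma strict_band_not_commute:
  assumes A: "strict_band n k A" and B: "strict_band n l B" and lk: "l \<le> k" and t: "t \<noteq> 0"
    and C: "C \<in> carrier_mat n n" and SC: "shear n t * C = A * shear n t"
  shows "C * B \<noteq> B * C"
proof
  assume CB: "C * B = B * C"
  have Ac: "A \<in> carrier_mat n n" and Bc: "B \<in> carrier_mat n n"
    using A B by (auto simp: strict_band_def)
  \<comment> \<open>\<open>B\<close> preserves the image of \<open>C\<close> and lowers the height of its vectors, so a vector of least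
    positive height would lie in the kernel of \<open>B\<close>.\<close>
  have zero: "C *\<^sub>v w = 0\<^sub>v n"
    if "w \<in> carrier_vec n" "\<And>i. i < n \<Longrightarrow> h \<le> i \<Longrightarrow> (C *\<^sub>v w) $ i = 0" for h w
    using that
  proof (induction h arbitrary: w)
    case 0
    then show ?case using C by auto
  next
    case (Suc h)
    let ?u = "C *\<^sub>v w"
    have u: "?u \<in> carrier_vec n" using C Suc.prems by simp
    have BC: "B *\<^sub>v ?u = C *\<^sub>v (B *\<^sub>v w)"
      using C Bc CB Suc.prems(1) by (simp flip: assoc_mult_mat_vec)
    have "B *\<^sub>v ?u = 0\<^sub>v n"
      unfolding BC
    proof (rule Suc.IH)
      fix i assume "i < n" "h \<le> i"
      then have "(B *\<^sub>v ?u) $ i = 0"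
        using B by (intro strict_band_mult_vec_eq_0[OF B u]) (auto intro!: Suc.prems(2) simp: strict_band_def)
      then show "(C *\<^sub>v (B *\<^sub>v w)) $ i = 0" by (simp add: BC)
    qed (use Bc Suc.prems in simp)
    note ker = strict_band_kernel[OF B u this]
    \<comment> \<open>The sheared vector lies in the image of \<open>A\<close>, so its coordinates
      vanish from \<open>n - k\<close> on, and \<open>n - k \<le> n - l\<close>.\<close>
    have S: "shear n t *\<^sub>v ?u = A *\<^sub>v (shear n t *\<^sub>v w)"
      using assoc_mult_mat_vec[OF shear_carrier C Suc.prems(1), of t] SC
        assoc_mult_mat_vec[OF Ac shear_carrier Suc.prems(1), of t] by simp
    show ?case
    proof (rule shear_transversal[OF u t, of l])
      fix i assume "i < n" "n - l \<le> i"
      then show "(shear n t *\<^sub>v ?u) $ i = 0"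
        unfolding S using lk Suc.prems(1)
        by (intro strict_band_mult_vec_eq_0[OF A] mult_mat_vec_carrier[OF shear_carrier]) auto
    qed (use ker in auto)
  qed
  have inv: "shear n t * shear n (- t) = 1\<^sub>m n"
    by (simp add: shear_mult shear_0)
  have "C = 0\<^sub>m n n"
  proof (rule eq_matI)
    fix i j assume "i < dim_row (0\<^sub>m n n :: 'a mat)" "j < dim_col (0\<^sub>m n n :: 'a mat)"
    then have ij: "i < n" "j < n" by auto
    \<comment> \<open>At \<open>h = n\<close> the height condition is vacuous.\<close>
    have "C *\<^sub>v unit_vec n j = 0\<^sub>v n"
      by (rule zero[of _ n]) auto
    moreover have "(C *\<^sub>v unit_vec n j) $ i = C $$ (i, j)"
      using ij C by (simp add: scalar_prod_right_unit[where i = j])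
    ultimately show "C $$ (i, j) = 0\<^sub>m n n $$ (i, j)"
      using ij by simp
  qed (use C in auto)
  then have "A * shear n t * shear n (- t) = 0\<^sub>m n n"
    using SC by (metis left_mult_zero_mat right_mult_zero_mat shear_carrier)
  then have "A = 0\<^sub>m n n"
    using Ac inv by (metis assoc_mult_mat right_mult_one_mat shear_carrier)
  moreover have "A $$ (0, k) \<noteq> 0" "k < n"
    using A unfolding strict_band_def by (metis add_0)+
  ultimately show False by simp
qed


section \<open>The centralizer of the nilpotent Jordan block\<close>

definition shift_mat :: "nat \<Rightarrow> 'a::field mat" where
  "shift_mat n = mat n n (\<lambda>(i, j). if j = Suc i then 1 else 0)"

lemma shift_mat_carrier [simp]: "shift_mat n \<in> carrier_mat n n"
  by (simp add: shift_mat_def)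

lemma mult_mat_index:
  assumes "A \<in> carrier_mat n n" "B \<in> carrier_mat n n" "i < n" "j < n"
  shows "(A * B) $$ (i, j) = (\<Sum>k<n. A $$ (i, k) * B $$ (k, j))"
  using assms by (auto simp: scalar_prod_def lessThan_atLeast0)

text \<open>Comparing an entry of the two products moves one step along a diagonal, and gives 0 when
  the step would leave column 0.\<close>

lemma commutes_shift_mat_toeplitz:
  assumes A: "A \<in> carrier_mat n n" and comm: "A * shift_mat n = shift_mat n * A"
    and "i < n" "j < n"
  shows "A $$ (i, j) = (if i \<le> j then A $$ (0, j - i) else 0)"
  using \<open>i < n\<close> \<open>j < n\<close>
proof (induction i arbitrary: j)
  case (Suc i)
  have "A $$ (Suc i, j) = (\<Sum>k<n. if k = Suc i then A $$ (Suc i, j) else 0)"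
    using Suc.prems by simp
  also have "\<dots> = (\<Sum>k<n. shift_mat n $$ (i, k) * A $$ (k, j))"
    using Suc.prems by (intro sum.cong) (auto simp: shift_mat_def)
  also have "\<dots> = (shift_mat n * A) $$ (i, j)"
    using Suc.prems A by (intro mult_mat_index[symmetric]) auto
  also have "\<dots> = (\<Sum>k<n. if Suc k = j then A $$ (i, k) else 0)"
    using Suc.prems A by (subst comm [symmetric], subst mult_mat_index) (auto simp: shift_mat_def intro!: sum.cong)
  also have "\<dots> = (if j = 0 then 0 else A $$ (i, j - 1))"
    using Suc.prems by (cases j) auto
  finally show ?case
    using Suc.IH[of "j - 1"] Suc.prems by (cases j) auto
qed simp

text \<open>The first row determines \<open>A\<close>: \<open>c\<close> is its first entry and
  \<open>k\<close> the next position with a nonzero one, which exists because \<open>A\<close> is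
  not scalar.\<close>

lemma commutes_shift_mat_strict_band:
  assumes A: "A \<in> carrier_mat n n" and comm: "A * shift_mat n = shift_mat n * A"
    and ns: "\<not> scalar_mat n A"
  obtains c k where "strict_band n k (A - c \<cdot>\<^sub>m 1\<^sub>m n)"
proof -
  note toep = commutes_shift_mat_toeplitz[OF A comm]
  define c where "c = A $$ (0, 0)"
  have "\<exists>k. 1 \<le> k \<and> k < n \<and> A $$ (0, k) \<noteq> 0"
  proof (rule ccontr)
    assume "\<not> ?thesis"
    then have z: "A $$ (0, k) = 0" if "1 \<le> k" "k < n" for k using that by blast
    have "A = c \<cdot>\<^sub>m 1\<^sub>m n"
    proof (rule eq_matI)
      fix i j assume "i < dim_row (c \<cdot>\<^sub>m 1\<^sub>m n)" "j < dim_col (c \<cdot>\<^sub>m 1\<^sub>m n)"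
      then show "A $$ (i, j) = (c \<cdot>\<^sub>m 1\<^sub>m n) $$ (i, j)"
        using toep[of i j] z[of "j - i"] by (auto simp: c_def)
    qed (use A in auto)
    with ns show False by (auto simp: scalar_mat_def)
  qed
  then obtain k where k: "1 \<le> k" "k < n" "A $$ (0, k) \<noteq> 0"
    and least: "\<And>m. m < k \<Longrightarrow> \<not> (1 \<le> m \<and> m < n \<and> A $$ (0, m) \<noteq> 0)"
    using exists_least_iff[of "\<lambda>k. 1 \<le> k \<and> k < n \<and> A $$ (0, k) \<noteq> 0"] by blast
  have "strict_band n k (A - c \<cdot>\<^sub>m 1\<^sub>m n)"
    unfolding strict_band_def
  proof (intro conjI allI impI)
    fix i j assume ij: "i < n" "j < n" "j < i + k"
    have "A $$ (i, j) = (if i = j then c else 0)"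
      using toep[OF ij(1,2)] least[of "j - i"] ij by (auto simp: c_def)
    then show "(A - c \<cdot>\<^sub>m 1\<^sub>m n) $$ (i, j) = 0"
      using A ij by simp
  next
    fix i assume "i + k < n"
    then show "(A - c \<cdot>\<^sub>m 1\<^sub>m n) $$ (i, i + k) \<noteq> 0"
      using A k toep[of i "i + k"] by simp
  qed (use A k in auto)
  then show ?thesis by (rule that)
qed

lemma commute_minus_scalar:
  fixes A :: "'a::field mat"
  assumes A: "A \<in> carrier_mat n n" and B: "B \<in> carrier_mat n n" and "A * B = B * A"
  shows "(A - c \<cdot>\<^sub>m 1\<^sub>m n) * B = B * (A - c \<cdot>\<^sub>m 1\<^sub>m n)"
proof -
  have cI: "c \<cdot>\<^sub>m 1\<^sub>m n \<in> carrier_mat n n" by simp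
  have "(A - c \<cdot>\<^sub>m 1\<^sub>m n) * B = A * B - c \<cdot>\<^sub>m B"
    using B by (simp add: minus_mult_distrib_mat[OF A cI B] mult_smult_assoc_mat[OF one_carrier_mat B])
  moreover have "B * (A - c \<cdot>\<^sub>m 1\<^sub>m n) = B * A - c \<cdot>\<^sub>m B"
    using B by (simp add: mult_minus_distrib_mat[OF B A cI] mult_smult_distrib[OF B one_carrier_mat])
  ultimately show ?thesis using assms(3) by simp
qed

section \<open>Conjugation by shears\<close>

definition shear_conj :: "nat \<Rightarrow> 'a::field \<Rightarrow> 'a mat \<Rightarrow> 'a mat" where
  "shear_conj n t A = shear n t * A * shear n (- t)"

lemma shear_conj_carrier [simp]:
  "A \<in> carrier_mat n n \<Longrightarrow> shear_conj n t A \<in> carrier_mat n n"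
  unfolding shear_conj_def by (intro mult_carrier_mat[of _ n n]) auto

text \<open>In right-associated products \<open>shear_mult\<close> cannot see adjacent shears; this
  form merges them.\<close>

lemma shear_shear_mult:
  "A \<in> carrier_mat n n \<Longrightarrow> shear n s * (shear n t * A) = shear n (s + t) * A"
  by (simp flip: assoc_mult_mat[OF shear_carrier shear_carrier] add: shear_mult)

lemma shear_conj_mult:
  assumes "A \<in> carrier_mat n n" "B \<in> carrier_mat n n"
  shows "shear_conj n t A * shear_conj n t B = shear_conj n t (A * B)"
  using assms
  by (simp add: shear_conj_def assoc_mult_mat[of _ n n _ n _ n] mult_carrier_mat[of _ n n _ n]
      shear_shear_mult shear_0)

lemma shear_conj_shear_conj:
  assumes "A \<in> carrier_mat n n"
  shows "shear_conj n s (shear_conj n t A) = shear_conj n (s + t) A"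
  using assms
  by (simp add: shear_conj_def assoc_mult_mat[of _ n n _ n _ n] mult_carrier_mat[of _ n n _ n]
      shear_shear_mult shear_mult add.commute)

lemma shear_conj_0: "A \<in> carrier_mat n n \<Longrightarrow> shear_conj n 0 A = A"
  by (simp add: shear_conj_def shear_0)

lemma shear_conj_commute_iff:
  assumes "A \<in> carrier_mat n n" "B \<in> carrier_mat n n"
  shows "shear_conj n t A * shear_conj n t B = shear_conj n t B * shear_conj n t A \<longleftrightarrow> A * B = B * A"
proof -
  have "A * B = B * A" if "shear_conj n t (A * B) = shear_conj n t (B * A)"
    using arg_cong[OF that, of "shear_conj n (- t)"] assms
    by (simp add: shear_conj_shear_conj shear_conj_0 mult_carrier_mat[of _ n n _ n])
  then show ?thesis
    using assms by (auto simp: shear_conj_mult)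
qed

lemma scalar_mat_shear_conj:
  assumes "A \<in> carrier_mat n n"
  shows "scalar_mat n (shear_conj n t A) \<longleftrightarrow> scalar_mat n A"
proof -
  have *: "shear_conj n s (c \<cdot>\<^sub>m 1\<^sub>m n) = c \<cdot>\<^sub>m 1\<^sub>m n" for s c :: 'a
    by (simp add: shear_conj_def mult_smult_distrib[OF shear_carrier one_carrier_mat]
        right_mult_one_mat[OF shear_carrier] mult_smult_assoc_mat[OF shear_carrier shear_carrier]
        shear_mult shear_0)
  show ?thesis
    unfolding scalar_mat_def using assms
    by (metis * add.left_inverse shear_conj_0 shear_conj_shear_conj)
qed

text \<open>Removing scalars preserves commutation and leaves two band matrices. The one with the
  smaller index must act as \<open>B\<close> in \<open>strict_band_not_commute\<close>, so both
  orders are prepared.\<close>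

lemma centralizers_not_commute:
  assumes A: "A \<in> carrier_mat n n" "A * shift_mat n = shift_mat n * A" "\<not> scalar_mat n A"
    and B: "B \<in> carrier_mat n n" "B * shift_mat n = shift_mat n * B" "\<not> scalar_mat n B"
    and t: "t \<noteq> 0"
  shows "shear_conj n t A * B \<noteq> B * shear_conj n t A"
proof
  assume comm: "shear_conj n t A * B = B * shear_conj n t A"
  obtain c k where band_A: "strict_band n k (A - c \<cdot>\<^sub>m 1\<^sub>m n)"
    using commutes_shift_mat_strict_band[OF A] .
  obtain d l where band_B: "strict_band n l (B - d \<cdot>\<^sub>m 1\<^sub>m n)"
    using commutes_shift_mat_strict_band[OF B] .
  let ?A = "A - c \<cdot>\<^sub>m 1\<^sub>m n" and ?B = "B - d \<cdot>\<^sub>m 1\<^sub>m n"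
  have cA: "?A \<in> carrier_mat n n" and cB: "?B \<in> carrier_mat n n"
    using A B by auto
  \<comment> \<open>Conjugating by \<open>- t\<close> exposes \<open>A\<close>, so that its scalar
    can be removed; conjugating back does the same for \<open>B\<close>.\<close>
  have "shear_conj n (- t) (shear_conj n t A) * shear_conj n (- t) B =
      shear_conj n (- t) B * shear_conj n (- t) (shear_conj n t A)"
    using comm A B by (subst shear_conj_commute_iff) auto
  then have "A * shear_conj n (- t) B = shear_conj n (- t) B * A"
    using A by (simp add: shear_conj_shear_conj shear_conj_0)
  then have "?A * shear_conj n (- t) B = shear_conj n (- t) B * ?A"
    using A B by (intro commute_minus_scalar) auto
  then have "shear_conj n t ?A * shear_conj n t (shear_conj n (- t) B) =
      shear_conj n t (shear_conj n (- t) B) * shear_conj n t ?A"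
    using cA B by (subst shear_conj_commute_iff) auto
  then have "B * shear_conj n t ?A = shear_conj n t ?A * B"
    using B by (simp add: shear_conj_shear_conj shear_conj_0)
  then have AB: "?B * shear_conj n t ?A = shear_conj n t ?A * ?B"
    using cA B by (intro commute_minus_scalar) auto
  then have "shear_conj n (- t) ?B * shear_conj n (- t) (shear_conj n t ?A) =
      shear_conj n (- t) (shear_conj n t ?A) * shear_conj n (- t) ?B"
    using cA cB by (subst shear_conj_commute_iff) auto
  then have BA: "shear_conj n (- t) ?B * ?A = ?A * shear_conj n (- t) ?B"
    using cA by (simp add: shear_conj_shear_conj shear_conj_0)
  \<comment> \<open>This supplies \<open>SC\<close>, with parameter \<open>- t\<close> in the first
    case below and \<open>t\<close> in the second.\<close>
  have inter: "shear n s * shear_conj n (- s) M = M * shear n s"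
    if "M \<in> carrier_mat n n" for s :: 'a and M
    using that
    by (simp add: shear_conj_def assoc_mult_mat[of _ n n _ n _ n] mult_carrier_mat[of _ n n _ n]
        shear_shear_mult shear_0)
  show False
  proof (cases "l \<le> k")
    case True
    show ?thesis
      using strict_band_not_commute[OF band_A band_B True, of "- t" "shear_conj n t ?A"]
        t AB cA inter[OF cA, of "- t"] by simp
  next
    case False
    then have "k \<le> l" by simp
    show ?thesis
      using strict_band_not_commute[OF band_B band_A \<open>k \<le> l\<close> t, of "shear_conj n (- t) ?B"]
        BA cB inter[OF cB, of t] by simp
  qed
qed

lemma shear_conj_centralizers_not_commute:
  assumes P: "P \<in> carrier_mat n n" "\<not> scalar_mat n P"
      "P * shear_conj n a (shift_mat n) = shear_conj n a (shift_mat n) * P"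
    and Q: "Q \<in> carrier_mat n n" "\<not> scalar_mat n Q"
      "Q * shear_conj n b (shift_mat n) = shear_conj n b (shift_mat n) * Q"
    and "a \<noteq> b"
  shows "P * Q \<noteq> Q * P"
proof
  assume "P * Q = Q * P"
  have commutes_shift: "shear_conj n (- c) M * shift_mat n = shift_mat n * shear_conj n (- c) M"
    if "M \<in> carrier_mat n n" "M * shear_conj n c (shift_mat n) = shear_conj n c (shift_mat n) * M"
    for c M
  proof -
    have "shear_conj n (- c) M * shear_conj n (- c) (shear_conj n c (shift_mat n)) =
        shear_conj n (- c) (shear_conj n c (shift_mat n)) * shear_conj n (- c) M"
      using that by (subst shear_conj_commute_iff) auto
    then show ?thesis
      by (simp add: shear_conj_shear_conj shear_conj_0)
  qed
  \<comment> \<open>Conjugating both matrices by \<open>- b\<close> leaves only the difference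
    \<open>a - b\<close>.\<close>
  have "shear_conj n (a - b) (shear_conj n (- a) P) * shear_conj n (- b) Q \<noteq>
      shear_conj n (- b) Q * shear_conj n (a - b) (shear_conj n (- a) P)"
    using assms by (intro centralizers_not_commute commutes_shift) (auto simp: scalar_mat_shear_conj)
  with \<open>P * Q = Q * P\<close> show False
    using P Q by (simp add: shear_conj_shear_conj shear_conj_commute_iff)
qed

section \<open>The common neighbour \<open>Z\<close> of the conjugated corner units\<close>

lemma mat_unit_carrier [simp]: "mat_unit n a b \<in> carrier_mat n n"
  by (simp add: mat_unit_def)

text \<open>Sandwiching keeps one entry of \<open>M\<close>, so such a product with a shear vanishes
  once that entry is 0.\<close>

lemma mat_unit_mult_mat_unit:
  assumes M: "M \<in> carrier_mat n n" and "b < n" "c < n"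
  shows "mat_unit n a b * M * mat_unit n c d = M $$ (b, c) \<cdot>\<^sub>m mat_unit n a d"
proof (rule eq_matI)
  fix i j assume "i < dim_row (M $$ (b, c) \<cdot>\<^sub>m mat_unit n a d)" "j < dim_col (M $$ (b, c) \<cdot>\<^sub>m mat_unit n a d)"
  then have ij: "i < n" "j < n" by (auto simp: mat_unit_def)
  have left: "(mat_unit n a b * M) $$ (i, k) = (if i = a then M $$ (b, k) else 0)" if "k < n" for k
  proof -
    have "(mat_unit n a b * M) $$ (i, k) = (\<Sum>m<n. mat_unit n a b $$ (i, m) * M $$ (m, k))"
      using ij that M by (intro mult_mat_index) auto
    also have "\<dots> = (\<Sum>m<n. if m = b then (if i = a then M $$ (b, k) else 0) else 0)"
      using ij that by (intro sum.cong) (auto simp: mat_unit_def)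
    finally show ?thesis using assms by simp
  qed
  have "(mat_unit n a b * M * mat_unit n c d) $$ (i, j) =
      (\<Sum>k<n. (mat_unit n a b * M) $$ (i, k) * mat_unit n c d $$ (k, j))"
    using ij M by (intro mult_mat_index) (auto intro!: mult_carrier_mat[of _ n n])
  also have "\<dots> = (\<Sum>k<n. if k = c then (if i = a \<and> j = d then M $$ (b, c) else 0) else 0)"
    using ij by (intro sum.cong) (simp_all add: left, simp add: mat_unit_def)
  finally show "(mat_unit n a b * M * mat_unit n c d) $$ (i, j) = (M $$ (b, c) \<cdot>\<^sub>m mat_unit n a d) $$ (i, j)"
    using ij assms by (simp add: mat_unit_def)
qed (use M in \<open>auto simp: mat_unit_def\<close>)

lemma not_scalar_mat_unit:
  assumes "a < n" "b < n" "2 \<le> n"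
  shows "\<not> scalar_mat n (mat_unit n a b :: 'a::field mat)"
proof
  assume "scalar_mat n (mat_unit n a b :: 'a mat)"
  then obtain c :: 'a where eq: "mat_unit n a b = c \<cdot>\<^sub>m 1\<^sub>m n"
    by (auto simp: scalar_mat_def)
  \<comment> \<open>A diagonal position off row \<open>a\<close>: the entry 0 there forces
    \<open>c = 0\<close>, against the entry 1 at \<open>(a, b)\<close>.\<close>
  define m where "m = (if a = 0 then 1 else 0 :: nat)"
  have m: "m < n" "m \<noteq> a" using assms by (auto simp: m_def)
  have "mat_unit n a b $$ (m, m) = (c \<cdot>\<^sub>m 1\<^sub>m n) $$ (m, m)"
    "mat_unit n a b $$ (a, b) = (c \<cdot>\<^sub>m 1\<^sub>m n) $$ (a, b)"
    using eq by simp_all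
  then show False
    using m assms by (auto simp: mat_unit_def split: if_splits)
qed

lemma not_scalar_shift_mat:
  assumes "2 \<le> n"
  shows "\<not> scalar_mat n (shift_mat n :: 'a::field mat)"
proof
  assume "scalar_mat n (shift_mat n :: 'a mat)"
  then obtain c :: 'a where eq: "shift_mat n = c \<cdot>\<^sub>m 1\<^sub>m n"
    by (auto simp: scalar_mat_def)
  have "shift_mat n $$ (0, 1) = (c \<cdot>\<^sub>m 1\<^sub>m n) $$ (0, 1)"
    using eq by simp
  then show False
    using assms by (auto simp: shift_mat_def)
qed

text \<open>Both products vanish, since the last row and the first column of the shift are
  zero.\<close>

lemma mat_unit_corner_commutes_shift_mat:
  "mat_unit n 0 (n - 1) * shift_mat n = shift_mat n * mat_unit n 0 (n - 1)"
proof -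
  have "mat_unit n 0 (n - 1) * shift_mat n = (0\<^sub>m n n :: 'a mat)"
    by (rule eq_matI)
      (auto simp: mult_mat_index mat_unit_def shift_mat_def scalar_prod_def intro!: sum.neutral)
  moreover have "shift_mat n * mat_unit n 0 (n - 1) = (0\<^sub>m n n :: 'a mat)"
    by (rule eq_matI)
      (auto simp: mat_unit_def shift_mat_def scalar_prod_def intro!: sum.neutral)
  ultimately show ?thesis by simp
qed

text \<open>For \<open>n \<ge> 3\<close> the entries \<open>(1, 0)\<close> and
  \<open>(n - 1, 1)\<close> of a shear lie off its diagonal and antidiagonal, so both products are
  0.\<close>

lemma shear_conj_corner_commutes:
  assumes "n \<ge> 3"
  shows "shear_conj n t (mat_unit n 0 (n - 1)) * mat_unit n 1 1 =
    mat_unit n 1 1 * shear_conj n t (mat_unit n 0 (n - 1))"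
proof -
  let ?E = "mat_unit n 0 (n - 1) :: 'a mat" and ?Z = "mat_unit n 1 1 :: 'a mat"
  have "?Z * shear n t * ?E = shear n t $$ (1, 0) \<cdot>\<^sub>m mat_unit n 1 (n - 1)"
    "?E * shear n (- t) * ?Z = shear n (- t) $$ (n - 1, 1) \<cdot>\<^sub>m mat_unit n 0 1"
    using assms by (auto intro!: mat_unit_mult_mat_unit)
  moreover have "shear n t $$ (1, 0) = 0" "shear n (- t) $$ (n - 1, 1) = 0"
    using assms by (auto simp: shear_def)
  ultimately have ZE: "?Z * shear n t * ?E = 0\<^sub>m n n" and EZ: "?E * shear n (- t) * ?Z = 0\<^sub>m n n"
    by (auto simp: mat_unit_def)
  have "shear_conj n t ?E * ?Z = shear n t * (?E * shear n (- t) * ?Z)"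
    by (simp add: shear_conj_def assoc_mult_mat[of _ n n _ n _ n] mult_carrier_mat[of _ n n _ n])
  moreover have "?Z * shear_conj n t ?E = ?Z * shear n t * ?E * shear n (- t)"
    by (simp add: shear_conj_def assoc_mult_mat[of _ n n _ n _ n] mult_carrier_mat[of _ n n _ n])
  ultimately show ?thesis
    using ZE EZ left_mult_zero_mat[OF shear_carrier] right_mult_zero_mat[OF shear_carrier] by metis
qed

section \<open>Distances in the commuting graph\<close>

lemma pverts_commuting_graph:
  "A \<in> pverts (commuting_graph n) \<longleftrightarrow> A \<in> carrier_mat n n \<and> \<not> scalar_mat n A"
  by (simp add: commuting_graph_def)

lemma parcs_commuting_graph:
  "(A, B) \<in> parcs (commuting_graph n) \<longleftrightarrow>
    A \<in> pverts (commuting_graph n) \<and> B \<in> pverts (commuting_graph n) \<and> A \<noteq> B \<and> A * B = B * A"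
  by (auto simp: commuting_graph_def)

lemma commuting_dist_eq_2:
  assumes V: "X \<in> pverts (commuting_graph n)" "P \<in> pverts (commuting_graph n)" "Z \<in> pverts (commuting_graph n)"
    and "X * P = P * X" "P * Z = Z * P" and nc: "X * Z \<noteq> Z * X"
  shows "commuting_dist n X Z = 2"
proof -
  interpret pair_bidirected_digraph "commuting_graph n"
    by (rule pair_bidirected_digraph_commuting_graph)
  have "commuting_dist n X Z = ereal (real 2)"
    unfolding commuting_dist_eq_iff
  proof (intro conjI allI impI exI)
    \<comment> \<open>\<open>X = P\<close> or \<open>P = Z\<close> would make \<open>X\<close> and
      \<open>Z\<close> commute.\<close>
    show "apath X [(X, P), (P, Z)] Z"
      using assms by (auto simp: apath_simps parcs_commuting_graph)
  next
    fix p assume p: "apath X p Z"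
    show "2 \<le> length p"
    proof (rule ccontr)
      assume "\<not> 2 \<le> length p"
      then consider "p = []" | e where "p = [e]"
        by (cases p; cases "tl p") auto
      then show False
        using p nc by cases (auto simp: apath_simps parcs_commuting_graph)
    qed
  qed simp
  then show ?thesis by simp
qed

text \<open>The inner vertices of a path of length 3 would violate \<open>nc\<close>; shorter paths
  do so with \<open>A\<close> and \<open>B\<close> equal or at the ends.\<close>

lemma commuting_dist_eq_4:
  assumes V: "X \<in> pverts (commuting_graph n)" "P \<in> pverts (commuting_graph n)" "Z \<in> pverts (commuting_graph n)"
      "Q \<in> pverts (commuting_graph n)" "Y \<in> pverts (commuting_graph n)"
    and E: "X * P = P * X" "P * Z = Z * P" "Z * Q = Q * Z" "Q * Y = Y * Q"
    and nc: "\<And>A B. A \<in> pverts (commuting_graph n) \<Longrightarrow> B \<in> pverts (commuting_graph n) \<Longrightarrow>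
      A * X = X * A \<Longrightarrow> B * Y = Y * B \<Longrightarrow> A * B \<noteq> B * A"
  shows "commuting_dist n X Y = 4"
proof -
  interpret pair_bidirected_digraph "commuting_graph n"
    by (rule pair_bidirected_digraph_commuting_graph)
  have "commuting_dist n X Y = ereal (real 4)"
    unfolding commuting_dist_eq_iff
  proof (intro conjI allI impI exI)
    \<comment> \<open>Any coincidence would shorten the route enough to violate
      \<open>nc\<close>.\<close>
    have "X \<noteq> P" "Z \<noteq> X" "P \<noteq> Z" "Z \<noteq> Q" "Q \<noteq> Y" "Z \<noteq> Y" "X \<noteq> Q" "X \<noteq> Y" "P \<noteq> Q" "P \<noteq> Y"
      using nc V E by metis+
    then show "apath X [(X, P), (P, Z), (Z, Q), (Q, Y)] Y"
      using V E by (auto simp: apath_simps parcs_commuting_graph)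
  next
    fix p assume p: "apath X p Y"
    show "4 \<le> length p"
    proof (rule ccontr)
      assume "\<not> 4 \<le> length p"
      then consider "p = []" | a b where "p = [(a, b)]" | a b c d where "p = [(a, b), (c, d)]"
        | a b c d e f where "p = [(a, b), (c, d), (e, f)]"
        by (cases p; cases "tl p"; cases "tl (tl p)"; cases "tl (tl (tl p))") auto
      then show False
      proof cases
        case 1
        then show ?thesis using p nc[of X X] V by (auto simp: apath_simps)
      next
        case 2
        then show ?thesis using p nc[of X Y] V by (auto simp: apath_simps parcs_commuting_graph)
      next
        case 3
        then show ?thesis using p nc[of b b] V by (auto simp: apath_simps parcs_commuting_graph)
      next
        case 4
        then show ?thesis using p nc[of b d] V by (auto simp: apath_simps parcs_commuting_graph)
      qed
    qed
  qed simp
  then show ?thesis by simp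
qed

theorem theorem2p7:
  fixes n :: nat
  assumes "n \<ge> 3"
  shows "\<exists>(I :: 'a::alg_closed_field set) (X :: 'a \<Rightarrow> 'a mat) (Z :: 'a mat).
    infinite I \<and>
    (\<forall>\<alpha>\<in>I. X \<alpha> \<in> pverts (commuting_graph n)) \<and>
    Z \<in> pverts (commuting_graph n) \<and> vec_space.rank n Z = 1 \<and>
    (\<forall>\<alpha>\<in>I. \<forall>\<beta>\<in>I. \<alpha> \<noteq> \<beta> \<longrightarrow> commuting_dist n (X \<alpha>) (X \<beta>) = 4) \<and>
    (\<forall>\<alpha>\<in>I. commuting_dist n (X \<alpha>) Z = 2)"
proof -
  define X :: "'a \<Rightarrow> 'a mat" where "X = (\<lambda>\<alpha>. shear_conj n \<alpha> (shift_mat n))"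
  define P :: "'a \<Rightarrow> 'a mat" where "P = (\<lambda>\<alpha>. shear_conj n \<alpha> (mat_unit n 0 (n - 1)))"
  define Z :: "'a mat" where "Z = mat_unit n 1 1"
  have X: "X \<alpha> \<in> pverts (commuting_graph n)" for \<alpha>
    using assms by (simp add: X_def pverts_commuting_graph scalar_mat_shear_conj not_scalar_shift_mat)
  have P: "P \<alpha> \<in> pverts (commuting_graph n)" for \<alpha>
    using assms by (simp add: P_def pverts_commuting_graph scalar_mat_shear_conj not_scalar_mat_unit)
  have Z: "Z \<in> pverts (commuting_graph n)"
    using assms by (simp add: Z_def pverts_commuting_graph not_scalar_mat_unit)
  have XP: "X \<alpha> * P \<alpha> = P \<alpha> * X \<alpha>" for \<alpha>
    unfolding X_def P_def
    by (rule shear_conj_commute_iff[THEN iffD2])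
      (simp_all only: shift_mat_carrier mat_unit_carrier mat_unit_corner_commutes_shift_mat)
  have PZ: "P \<alpha> * Z = Z * P \<alpha>" for \<alpha>
    unfolding P_def Z_def using assms by (rule shear_conj_corner_commutes)
  have nc: "A * B \<noteq> B * A"
    if "\<alpha> \<noteq> \<beta>" "A \<in> pverts (commuting_graph n)" "B \<in> pverts (commuting_graph n)"
      "A * X \<alpha> = X \<alpha> * A" "B * X \<beta> = X \<beta> * B" for A B \<alpha> \<beta>
    using that shear_conj_centralizers_not_commute[of A n \<alpha> B \<beta>]
    by (simp add: X_def pverts_commuting_graph)
  \<comment> \<open>Otherwise \<open>Z\<close> and \<open>P (\<alpha> + 1)\<close> would be
    commuting neighbours of members with distinct parameters.\<close>
  have "X \<alpha> * Z \<noteq> Z * X \<alpha>" for \<alpha>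
    using nc[of \<alpha> "\<alpha> + 1" Z "P (\<alpha> + 1)"] Z P XP PZ by (metis add_cancel_left_right zero_neq_one)
  then have "commuting_dist n (X \<alpha>) Z = 2" for \<alpha>
    using commuting_dist_eq_2[OF X P Z XP PZ] by blast
  moreover have "commuting_dist n (X \<alpha>) (X \<beta>) = 4" if "\<alpha> \<noteq> \<beta>" for \<alpha> \<beta>
    by (rule commuting_dist_eq_4[OF X P Z P X XP PZ PZ[symmetric] XP[symmetric]])
      (use nc that in blast)
  moreover have "vec_space.rank n Z = 1"
    using assms unfolding Z_def by (intro rank_mat_unit) auto
  \<comment> \<open>The index set is the whole field.\<close>
  ultimately show ?thesis
    using X Z infinite_UNIV_alg_closed_field[where ?'a = 'a] by blast
qed

end
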